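(* For any integer $n\geq 2$, the $n$-step nilpotent Lie algebra $T^*\mathfrak g$, where $\mathfrak g=\mathbb R\ltimes_{J_n(0)}\mathbb R^n$, admits uncountably many pairwise non-isomorphic complete left-symmetric structures.
   Context: Lie algebras are real and finite-dimensional. A left-symmetric structure on a Lie algebra $\mathfrak h$ is a bilinear product $\triangle:\mathfrak h\times\mathfrak h\to\mathfrak h$ with $x\triangle(y\triangle z)-(x\triangle y)\triangle z=y\triangle(x\triangle z)-(y\triangle x)\triangle z$ and $[x,y]=x\triangle y-y\triangle x$ for all $x,y,z$. It is complete if for every $x\in\mathfrak h$ the right translation $r_x:y\mapsto y\triangle x$ is a nilpotent endomorphism. Left-symmetric structures $\triangle$ on $\mathfrak h$ and $\triangle'$ on $\mathfrak h'$ are isomorphic if there is a Lie algebra isomorphism $\phi:\mathfrak h\to\mathfrak h'$ with $\phi(x\triangle y)=\phi(x)\triangle'\phi(y)$ for all $x,y$. For an integer $n\ge2$, $\mathfrak g=\mathbb R\ltimes_{J_n(0)}\mathbb R^n$ is the $(n+1)$-dimensional Lie algebra with basis $t,e_1,\dots,e_n$ whose only nonzero brackets (up to antisymmetry) are $[t,e_{i+1}]=e_i$, $i=1,\dots,n-1$. The cotangent Lie algebra $T^*\mathfrak g=\mathfrak g\oplus\mathfrak g^*$ has bracket $[x+\phi,y+\psi]=[x,y]_{\mathfrak g}+\mathrm{ad}^*_x\psi-\mathrm{ad}^*_y\phi$, where $\mathrm{ad}^*_x\phi=-\phi\circ\mathrm{ad}_x$. Let $z,e^1,\dots,e^n$ be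 the basis of $\mathfrak g^*$ dual to $t,e_1,\dots,e_n$ and put $f_i=e^{n-i+1}$. Then $T^*\mathfrak g$ has basis $z,e_1,f_1,\dots,e_n,f_n,t$, and its nonzero brackets (up to antisymmetry) are, for $i=1,\dots,n-1$: $[t,e_{i+1}]=e_i$, $[t,f_{i+1}]=-f_i$, $[e_{i+1},f_{n-i+1}]=z$. *)

theory Defs
  imports "HOL-Analysis.Analysis"
begin

definition lie_algebra :: "('a::real_vector \<Rightarrow> 'a \<Rightarrow> 'a) \<Rightarrow> bool" where
  "lie_algebra br \<longleftrightarrow>
     (\<exists>B::'a set. finite B \<and> span B = UNIV) \<and>
     bilinear br \<and>
     (\<forall>x. br x x = 0) \<and>
     (\<forall>x y z. br x (br y z) + br y (br z x) + br z (br x y) = 0)"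

primrec lower_central_series :: "('a::real_vector \<Rightarrow> 'a \<Rightarrow> 'a) \<Rightarrow> nat \<Rightarrow> 'a set" where
  "lower_central_series br 0 = UNIV"
| "lower_central_series br (Suc k) =
     span {br x y | x y. y \<in> lower_central_series br k}"

definition step_nilpotent :: "nat \<Rightarrow> ('a::real_vector \<Rightarrow> 'a \<Rightarrow> 'a) \<Rightarrow> bool" where
  "step_nilpotent n br \<longleftrightarrow>
     lower_central_series br n = {0} \<and> (\<forall>k<n. lower_central_series br k \<noteq> {0})"

definition left_symmetric_structure ::
    "('a::real_vector \<Rightarrow> 'a \<Rightarrow> 'a) \<Rightarrow> ('a \<Rightarrow> 'a \<Rightarrow> 'a) \<Rightarrow> bool" where
  "left_symmetric_structure br p \<longleftrightarrow>
     bilinear p \<and>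
     (\<forall>x y z. p x (p y z) - p (p x y) z = p y (p x z) - p (p y x) z) \<and>
     (\<forall>x y. br x y = p x y - p y x)"

definition nilpotent_endo :: "('a::real_vector \<Rightarrow> 'a) \<Rightarrow> bool" where
  "nilpotent_endo f \<longleftrightarrow> linear f \<and> (\<exists>k. \<forall>v. (f ^^ k) v = 0)"

definition complete_product :: "('a::real_vector \<Rightarrow> 'a \<Rightarrow> 'a) \<Rightarrow> bool" where
  "complete_product p \<longleftrightarrow> (\<forall>x. nilpotent_endo (\<lambda>y. p y x))"

definition lie_isomorphism ::
    "('a::real_vector \<Rightarrow> 'a \<Rightarrow> 'a) \<Rightarrow> ('b::real_vector \<Rightarrow> 'b \<Rightarrow> 'b) \<Rightarrow> ('a \<Rightarrow> 'b) \<Rightarrow> bool" where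
  "lie_isomorphism br br' h \<longleftrightarrow>
     linear h \<and> bij h \<and> (\<forall>x y. h (br x y) = br' (h x) (h y))"

definition left_symmetric_isomorphic ::
    "('a::real_vector \<Rightarrow> 'a \<Rightarrow> 'a) \<Rightarrow> ('a \<Rightarrow> 'a \<Rightarrow> 'a) \<Rightarrow>
     ('b::real_vector \<Rightarrow> 'b \<Rightarrow> 'b) \<Rightarrow> ('b \<Rightarrow> 'b \<Rightarrow> 'b) \<Rightarrow> bool" where
  "left_symmetric_isomorphic br p br' p' \<longleftrightarrow>
     (\<exists>h. lie_isomorphism br br' h \<and> (\<forall>x y. h (p x y) = p' (h x) (h y)))"

(* An enumeration idx of the index type by 1..n names the standard basis:
   e_i is axis (idx i) 1. The block has ones on the superdiagonal, so that
   J_n(0) sends e_(i+1) to e_i and e_1 to 0. *)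
definition jordan_block_matrix :: "(nat \<Rightarrow> 'n::finite) \<Rightarrow> nat \<Rightarrow> real \<Rightarrow> real^'n^'n" where
  "jordan_block_matrix idx n c =
     (\<chi> i j. if i = j then c
             else if \<exists>k\<in>{1..<n}. i = idx k \<and> j = idx (Suc k) then 1 else 0)"

(* Bracket of the semidirect product of R with R^n by a matrix A; the
   generator t is (1, 0) and [t, v] = A v for v in R^n. *)
definition semidirect_bracket ::
    "real^'n^'n \<Rightarrow> real \<times> (real^'n) \<Rightarrow> real \<times> (real^'n) \<Rightarrow> real \<times> (real^'n)" where
  "semidirect_bracket A x y = (0, fst x *\<^sub>R (A *v snd y) - fst y *\<^sub>R (A *v snd x))"

(* The dual of a finite-dimensional space is rendered as the type of bounded
   linear functionals on it, since every linear functional is bounded there.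
   For a bilinear bracket the argument of Blinfun is bounded linear. *)
definition coadjoint ::
    "('a::euclidean_space \<Rightarrow> 'a \<Rightarrow> 'a) \<Rightarrow> 'a \<Rightarrow> ('a \<Rightarrow>\<^sub>L real) \<Rightarrow> ('a \<Rightarrow>\<^sub>L real)" where
  "coadjoint br x \<phi> = Blinfun (\<lambda>y. - blinfun_apply \<phi> (br x y))"

definition cotangent_bracket ::
    "('a::euclidean_space \<Rightarrow> 'a \<Rightarrow> 'a) \<Rightarrow>
     'a \<times> ('a \<Rightarrow>\<^sub>L real) \<Rightarrow> 'a \<times> ('a \<Rightarrow>\<^sub>L real) \<Rightarrow> 'a \<times> ('a \<Rightarrow>\<^sub>L real)" where
  "cotangent_bracket br X Y =
     (br (fst X) (fst Y), coadjoint br (fst X) (snd Y) - coadjoint br (fst Y) (snd X))"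

type_synonym 'n cotangent_space =
  "(real \<times> (real^'n)) \<times> ((real \<times> (real^'n)) \<Rightarrow>\<^sub>L real)"

definition cotangent_jordan_bracket ::
    "(nat \<Rightarrow> 'n::finite) \<Rightarrow> nat \<Rightarrow>
     'n cotangent_space \<Rightarrow> 'n cotangent_space \<Rightarrow> 'n cotangent_space" where
  "cotangent_jordan_bracket idx n =
     cotangent_bracket (semidirect_bracket (jordan_block_matrix idx n 0))"

end

theory Submission
  imports Defs
begin

text \<open>For a square matrix \<open>A\<close> and \<open>V = \<real>\<^sup>n\<close>, put \<open>D = (A, -A\<^sup>T)\<close> on
  \<open>V \<oplus> V\<^sup>*\<close>. The cotangent algebra of \<open>\<real> \<ltimes>\<^sub>A V\<close> has \<open>[t, v] = D v\<close> and
  \<open>[v, w] = \<omega>(v, w) z\<close> for \<open>v, w \<in> V \<oplus> V\<^sup>*\<close>, where \<open>\<omega>(v, \<psi>) = \<psi> (A v)\<close> for \<open>v \<in> V\<close>, \<open>\<psi> \<in> V\<^sup>*\<close>.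
  For each real \<open>c\<close>, the rules \<open>t \<cdot> v = D v\<close>, \<open>v \<cdot> \<psi> = c \<omega>(v, \<psi>) z\<close>, \<open>\<psi> \<cdot> v = (c - 1) \<omega>(v, \<psi>) z\<close>
  give a left-symmetric product because the bilinear form involved is invariant under \<open>D\<close>; all
  right translations have vanishing cube. The hyperplane \<open>M\<close> where the coefficient of \<open>t\<close> vanishes
  consists of the elements whose left translation has rank at most one. The ratios \<open>k\<close> for which
  some \<open>x \<in> M\<close> satisfies \<open>x \<cdot> y = k (y \<cdot> x)\<close> for all \<open>y \<in> M\<close>, not both sides vanishing identically, are
  \<open>c / (c - 1)\<close> and its inverse, when \<open>A \<noteq> 0\<close> and \<open>c > 1\<close>, so these products are
  pairwise non-isomorphic.\<close>

section \<open>Functionals on vectors of \<open>V\<close> and the coadjoint action\<close>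

text \<open>Functionals are mostly evaluated at pairs \<open>(0, v)\<close>. These are not
  syntactically sums or multiples of pairs, so the linearity rules of \<open>blinfun_apply\<close>
  do not rewrite them; this and the next four facts fill the gap.\<close>

lemma blinfun_Pair0_scaleR [simp]:
  "blinfun_apply f (0, r *\<^sub>R x) = r *\<^sub>R blinfun_apply f (0, x)"
  using blinfun.scaleR_right[of f r "(0, x)"] by simp

lemma blinfun_Pair0_add:
  "blinfun_apply f (0, x + y) = blinfun_apply f (0, x) + blinfun_apply f (0, y)"
  using blinfun.add_right[of f "(0, x)" "(0, y)"] by simp

lemma blinfun_Pair0_diff:
  "blinfun_apply f (0, x - y) = blinfun_apply f (0, x) - blinfun_apply f (0, y)"
  using blinfun.diff_right[of f "(0, x)" "(0, y)"] by simp

lemma blinfun_Pair0_minus: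
  "blinfun_apply f (0, - x) = - blinfun_apply f (0, x)"
  using blinfun.minus_right[of f "(0, x)"] by simp

lemma blinfun_Pair0_0 [simp]: "blinfun_apply f (0, 0) = 0"
  using blinfun.zero_right[of f] by (simp add: zero_prod_def)

lemma bilinear_semidirect_bracket: "bilinear (semidirect_bracket A)"
  unfolding bilinear_def semidirect_bracket_def
  by (auto intro!: linearI simp: matrix_vector_right_distrib matrix_vector_mult_scaleR algebra_simps)

lemma coadjoint_apply [simp]:
  assumes "bilinear br"
  shows "blinfun_apply (coadjoint br x \<phi>) y = - blinfun_apply \<phi> (br x y)"
proof -
  have "bounded_linear (\<lambda>y. br x y)"
    using assms by (simp add: bilinear_def linear_conv_bounded_linear)
  then have "bounded_linear (\<lambda>y. - blinfun_apply \<phi> (br x y))"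
    by (intro bounded_linear_minus bounded_linear_compose[OF blinfun.bounded_linear_right])
  then show ?thesis
    by (simp add: coadjoint_def bounded_linear_Blinfun_apply)
qed

lemma ex_blinfun_neq_0:
  fixes v :: "'a::euclidean_space"
  assumes "v \<noteq> 0"
  shows "\<exists>\<psi>::(real \<times> 'a) \<Rightarrow>\<^sub>L real. blinfun_apply \<psi> (0, v) \<noteq> 0"
  using assms by (intro exI[of _ "blinfun_inner_right (0, v)"]) simp

section \<open>The one-parameter family of complete left-symmetric products\<close>

text \<open>In the functional component, the first summand is the coadjoint action of the
  \<open>t\<close>-part of \<open>X\<close>; the second is a multiple of z, the functional
  \<open>y \<mapsto> fst y\<close> dual to \<open>t\<close>.\<close>

definition cotangent_product ::
    "real^'n^'n \<Rightarrow> real \<Rightarrow> 'n cotangent_space \<Rightarrow> 'n cotangent_space \<Rightarrow> 'n cotangent_space" where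
  "cotangent_product A c X Y =
     ((0, fst (fst X) *\<^sub>R (A *v snd (fst Y))),
      Blinfun (\<lambda>y. - fst (fst X) * blinfun_apply (snd Y) (0, A *v snd y) +
        fst y * (c * blinfun_apply (snd Y) (0, A *v snd (fst X)) +
                 (c - 1) * blinfun_apply (snd X) (0, A *v snd (fst Y)))))"

lemma fst_cotangent_product [simp]:
  "fst (cotangent_product A c X Y) = (0, fst (fst X) *\<^sub>R (A *v snd (fst Y)))"
  by (simp add: cotangent_product_def)

lemma snd_cotangent_product_apply [simp]:
  "blinfun_apply (snd (cotangent_product A c X Y)) y =
     - fst (fst X) * blinfun_apply (snd Y) (0, A *v snd y) +
     fst y * (c * blinfun_apply (snd Y) (0, A *v snd (fst X)) +
              (c - 1) * blinfun_apply (snd X) (0, A *v snd (fst Y)))"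
proof -
  have "linear (\<lambda>y. - fst (fst X) * blinfun_apply (snd Y) (0, A *v snd y) +
        fst y * (c * blinfun_apply (snd Y) (0, A *v snd (fst X)) +
                 (c - 1) * blinfun_apply (snd X) (0, A *v snd (fst Y))))"
    by (rule linearI)
      (auto simp: matrix_vector_right_distrib matrix_vector_mult_scaleR blinfun_Pair0_add
        algebra_simps)
  then show ?thesis
    by (simp add: cotangent_product_def bounded_linear_Blinfun_apply linear_conv_bounded_linear)
qed

lemma cotangent_space_eqI:
  fixes X Y :: "('a::real_normed_vector) \<times> ('a \<Rightarrow>\<^sub>L real)"
  assumes "fst X = fst Y"
    and "\<And>y. blinfun_apply (snd X) y = blinfun_apply (snd Y) y"
  shows "X = Y"
  using assms by (intro prod_eqI blinfun_eqI) auto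

lemma bilinear_cotangent_product: "bilinear (cotangent_product A c)"
  unfolding bilinear_def
  by (auto intro!: linearI cotangent_space_eqI
      simp: matrix_vector_right_distrib matrix_vector_mult_scaleR blinfun_Pair0_add
        blinfun.add_left blinfun.scaleR_left algebra_simps)

lemma left_symmetric_structure_cotangent_product:
  "left_symmetric_structure (cotangent_bracket (semidirect_bracket A)) (cotangent_product A c)"
  unfolding left_symmetric_structure_def
proof (intro conjI allI bilinear_cotangent_product)
  fix X Y Z :: "'a cotangent_space"
  let ?p = "cotangent_product A c"
  show "?p X (?p Y Z) - ?p (?p X Y) Z = ?p Y (?p X Z) - ?p (?p Y X) Z"
    by (rule cotangent_space_eqI)
      (auto simp: matrix_vector_mult_scaleR blinfun.diff_left algebra_simps)
  show "cotangent_bracket (semidirect_bracket A) X Y = ?p X Y - ?p Y X"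
    by (rule cotangent_space_eqI)
      (auto simp: cotangent_bracket_def bilinear_semidirect_bracket semidirect_bracket_def
        blinfun.diff_left blinfun_Pair0_diff algebra_simps)
qed

lemma complete_cotangent_product: "complete_product (cotangent_product A c)"
  unfolding complete_product_def nilpotent_endo_def
proof (intro allI conjI exI)
  fix X Y :: "'a cotangent_space"
  show "linear (\<lambda>Y. cotangent_product A c Y X)"
    using bilinear_cotangent_product[of A c] unfolding bilinear_def by blast
  \<comment> \<open>One application removes the \<open>t\<close>-coefficient, a second lands in the
    line of z, and z times anything is 0.\<close>
  show "((\<lambda>Y. cotangent_product A c Y X) ^^ 3) Y = 0"
    by (rule cotangent_space_eqI) (simp_all add: numeral_3_eq_3 zero_prod_def)
qed

section \<open>The Lie algebra axioms\<close>

text \<open>The Jacobi sum of a commutator is the sum of the left-symmetry identities at (x,y,z),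
  (y,z,x) and (z,x,y).\<close>

lemma jacobi_left_symmetric_structure:
  assumes "left_symmetric_structure br p"
  shows "br x (br y z) + br y (br z x) + br z (br x y) = 0"
proof -
  have bil: "bilinear p"
    and assoc: "\<And>x y z. p x (p y z) - p (p x y) z - p y (p x z) + p (p y x) z = 0"
    and br: "\<And>x y. br x y = p x y - p y x"
    using assms by (auto simp: left_symmetric_structure_def algebra_simps)
  have "br x (br y z) + br y (br z x) + br z (br x y) =
      (p x (p y z) - p (p x y) z - p y (p x z) + p (p y x) z) +
      (p y (p z x) - p (p y z) x - p z (p y x) + p (p z y) x) +
      (p z (p x y) - p (p z x) y - p x (p z y) + p (p x z) y)"
    by (simp add: br bilinear_lsub[OF bil] bilinear_rsub[OF bil])
  then show ?thesis by (simp add: assoc)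
qed

text \<open>By Riesz representation the inner product identifies the dual with the space itself, so
  a basis of \<open>'a \<times> 'a\<close> is carried to a spanning set.\<close>

lemma finite_span_cotangent_space:
  "\<exists>B::('a::euclidean_space \<times> ('a \<Rightarrow>\<^sub>L real)) set. finite B \<and> span B = UNIV"
proof -
  let ?h = "\<lambda>x::'a \<times> 'a. (fst x, blinfun_inner_right (snd x))"
  have lin: "linear ?h"
    by (rule linearI) (auto intro!: blinfun_eqI simp: blinfun.add_left blinfun.scaleR_left inner_left_distrib)
  have surj: "X \<in> range ?h" for X
  proof -
    have "X = ?h (fst X, \<Sum>b\<in>Basis. blinfun_apply (snd X) b *\<^sub>R b)"
    proof (rule cotangent_space_eqI)
      fix y
      have "blinfun_apply (snd X) y = blinfun_apply (snd X) (\<Sum>b\<in>Basis. (y \<bullet> b) *\<^sub>R b)"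
        by (simp add: euclidean_representation)
      also have "\<dots> = (\<Sum>b\<in>Basis. blinfun_apply (snd X) b *\<^sub>R b) \<bullet> y"
        by (simp only: blinfun.sum_right blinfun.scaleR_right inner_sum_left)
          (simp add: inner_commute mult.commute)
      finally show "blinfun_apply (snd X) y =
          blinfun_apply (snd (?h (fst X, \<Sum>b\<in>Basis. blinfun_apply (snd X) b *\<^sub>R b))) y"
        by simp
    qed simp
    then show ?thesis by blast
  qed
  have "span (?h ` Basis) = range ?h"
    using linear_span_image[OF lin, of Basis] by simp
  then show ?thesis
    using surj by (intro exI[of _ "?h ` Basis"]) auto
qed

lemma lie_algebra_cotangent_bracket:
  fixes A :: "real^'n^'n"
  shows "lie_algebra (cotangent_bracket (semidirect_bracket A))"
proof -
  \<comment> \<open>All the products have the same commutator; the value 0 is an arbitrary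
    choice.\<close>
  note ls = left_symmetric_structure_cotangent_product[of A 0]
  have br: "cotangent_bracket (semidirect_bracket A) =
      (\<lambda>X Y. cotangent_product A 0 X Y - cotangent_product A 0 Y X)"
    using ls by (auto simp: left_symmetric_structure_def fun_eq_iff)
  have "bilinear (cotangent_bracket (semidirect_bracket A))"
    using bilinear_cotangent_product[of A 0] unfolding br bilinear_def
    by (intro conjI allI linear_compose_sub) blast+
  then show ?thesis
    unfolding lie_algebra_def
    using finite_span_cotangent_space jacobi_left_symmetric_structure[OF ls]
    by (auto simp: br)
qed

section \<open>An isomorphism invariant of left-symmetric products\<close>

text \<open>Describes the hyperplane \<open>M\<close> through the product alone, so that
  isomorphisms preserve it; \<open>w\<close> may be 0, so rank 0 is included.\<close>

definition rank_one_left :: "('a::real_vector \<Rightarrow> 'a \<Rightarrow> 'a) \<Rightarrow> 'a set" where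
  "rank_one_left p = {x. \<exists>w. \<forall>y. p x y \<in> span {w}}"

text \<open>The last conjunct excludes elements such as 0 or z, for which every \<open>k\<close>
  would qualify.\<close>

definition commutation_ratio :: "('a::real_vector \<Rightarrow> 'a \<Rightarrow> 'a) \<Rightarrow> real \<Rightarrow> bool" where
  "commutation_ratio p k \<longleftrightarrow>
     (\<exists>x\<in>rank_one_left p. (\<forall>y\<in>rank_one_left p. p x y = k *\<^sub>R p y x) \<and>
        (\<exists>y\<in>rank_one_left p. p y x \<noteq> 0))"

lemma rank_one_left_isomorphism:
  assumes "linear h" "bij h" "\<And>x y. h (p x y) = q (h x) (h y)"
  shows "rank_one_left q = h ` rank_one_left p"
proof -
  have span: "h u \<in> span {h w} \<longleftrightarrow> u \<in> span {w}" for u w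
    using linear_span_image[OF assms(1), of "{w}"] bij_is_inj[OF assms(2)]
    by (simp add: inj_image_mem_iff)
  have "h -` rank_one_left q = rank_one_left p"
  proof (rule set_eqI)
    fix x
    have "h x \<in> rank_one_left q \<longleftrightarrow> (\<exists>w. \<forall>y. q (h x) (h y) \<in> span {h w})"
      using bij_is_surj[OF assms(2)] unfolding rank_one_left_def surj_def mem_Collect_eq by metis
    then show "x \<in> h -` rank_one_left q \<longleftrightarrow> x \<in> rank_one_left p"
      by (simp add: rank_one_left_def flip: assms(3)) (simp add: span)
  qed
  then show ?thesis
    using surj_image_vimage_eq[OF bij_is_surj[OF assms(2)]] by metis
qed

lemma commutation_ratio_isomorphic:
  assumes "left_symmetric_isomorphic br p br' q" "commutation_ratio p k"
  shows "commutation_ratio q k"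
proof -
  obtain h where h: "linear h" "bij h" "\<And>x y. h (p x y) = q (h x) (h y)"
    using assms(1) by (auto simp: left_symmetric_isomorphic_def lie_isomorphism_def)
  obtain x y where xy: "x \<in> rank_one_left p" "\<And>y. y \<in> rank_one_left p \<Longrightarrow> p x y = k *\<^sub>R p y x"
      "y \<in> rank_one_left p" "p y x \<noteq> 0"
    using assms(2) by (auto simp: commutation_ratio_def)
  have R: "rank_one_left q = h ` rank_one_left p"
    by (rule rank_one_left_isomorphism[OF h(1,2)]) (rule h(3))
  have "q (h x) (h y) = k *\<^sub>R q (h y) (h x)" if "y \<in> rank_one_left p" for y
    using xy(2)[OF that] linear_cmul[OF h(1), of k "p y x"] by (simp flip: h(3))
  then have ratio: "\<forall>v\<in>rank_one_left q. q (h x) v = k *\<^sub>R q v (h x)"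
    by (simp add: R)
  have nonzero: "q (h y) (h x) \<noteq> 0"
    using xy(4) linear_injective_0[OF h(1)] bij_is_inj[OF h(2)] by (auto simp flip: h(3))
  have mem: "h x \<in> rank_one_left q" "h y \<in> rank_one_left q"
    using xy(1,3) by (auto simp: R)
  show ?thesis
    unfolding commutation_ratio_def
    by (rule bexI[where x = "h x"], rule conjI[OF ratio], rule bexI[where x = "h y"];
        rule nonzero mem)
qed

section \<open>The invariant for the products of the family\<close>

text \<open>If the \<open>t\<close>-coefficient of \<open>X\<close> is nonzero, left translation by
  \<open>X\<close> gives \<open>v0\<close> a nonzero \<open>V\<close>-part, and sends a functional
  that is nonzero on \<open>A *v v0\<close> to a nonzero element without \<open>V\<close>-part; no
  line contains both images.\<close>

lemma rank_one_left_cotangent_product: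
  assumes "A *v v0 \<noteq> 0"
  shows "rank_one_left (cotangent_product A c) = {X. fst (fst X) = 0}"
proof (intro equalityI subsetI)
  fix X assume "X \<in> rank_one_left (cotangent_product A c)"
  then obtain W where W: "\<And>Y. cotangent_product A c X Y \<in> span {W}"
    by (auto simp: rank_one_left_def)
  obtain \<psi> :: "(real \<times> (real^'a)) \<Rightarrow>\<^sub>L real" where \<psi>: "blinfun_apply \<psi> (0, A *v v0) \<noteq> 0"
    using ex_blinfun_neq_0[OF assms] by blast
  obtain a where a: "cotangent_product A c X ((0, v0), 0) = a *\<^sub>R W"
    using W unfolding span_singleton by blast
  obtain b where b: "cotangent_product A c X (0, \<psi>) = b *\<^sub>R W"
    using W unfolding span_singleton by blast
  have "fst (fst X) *\<^sub>R (A *v v0) = a *\<^sub>R snd (fst W)"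
    using arg_cong[OF a, of "\<lambda>x. snd (fst x)"] by simp
  moreover have "0 = b *\<^sub>R snd (fst W)"
    using arg_cong[OF b, of "\<lambda>x. snd (fst x)"] by simp
  moreover have "- fst (fst X) * blinfun_apply \<psi> (0, A *v v0) = b * blinfun_apply (snd W) (0, v0)"
    using arg_cong[OF b, of "\<lambda>x. blinfun_apply (snd x) (0, v0)"] by (simp add: blinfun.scaleR_left)
  ultimately show "X \<in> {X. fst (fst X) = 0}"
    using assms \<psi> by auto
next
  fix X :: "'a cotangent_space" assume "X \<in> {X. fst (fst X) = 0}"
  then have X: "fst (fst X) = 0" by simp
  \<comment> \<open>\<open>blinfun_inner_right (1, 0)\<close> is z, and evaluation at
    \<open>t = (1, 0)\<close> reads off its coefficient.\<close>
  have "cotangent_product A c X Y \<in> span {(0, blinfun_inner_right (1, 0))}" for Y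
    unfolding span_singleton
    by (rule range_eqI[of _ _ "blinfun_apply (snd (cotangent_product A c X Y)) (1, 0)"],
        rule cotangent_space_eqI)
      (auto simp: X blinfun.scaleR_left zero_prod_def)
  then show "X \<in> rank_one_left (cotangent_product A c)"
    unfolding rank_one_left_def by blast
qed

text \<open>On \<open>M\<close> the product is a z-valued bilinear form. Testing \<open>X\<close>
  against functionals yields the factor \<open>c - k * (c - 1)\<close>, against vectors
  \<open>(c - 1) - k * c\<close>. If neither vanishes, then \<open>X\<close> is annihilated by all
  of \<open>M\<close>. Conversely, \<open>v0\<close> and a functional nonzero on
  \<open>A *v v0\<close> realise the two ratios.\<close>

lemma commutation_ratio_cotangent_product:
  assumes "A *v v0 \<noteq> 0" "c > 1"
  shows "commutation_ratio (cotangent_product A c) k \<longleftrightarrow> k = c / (c - 1) \<or> k = (c - 1) / c"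
    (is "?L \<longleftrightarrow> ?R")
proof
  assume ?L
  let ?p = "cotangent_product A c"
  obtain X Y where X: "fst (fst X) = 0" and Y: "fst (fst Y) = 0" and nz: "?p Y X \<noteq> 0"
    and eq: "\<And>Z. fst (fst Z) = 0 \<Longrightarrow> ?p X Z = k *\<^sub>R ?p Z X"
    using \<open>?L\<close> by (auto simp: commutation_ratio_def rank_one_left_cotangent_product[OF assms(1)])
  have eq': "c * blinfun_apply (snd Z) (0, A *v snd (fst X)) +
      (c - 1) * blinfun_apply (snd X) (0, A *v snd (fst Z)) =
      k * (c * blinfun_apply (snd X) (0, A *v snd (fst Z)) +
      (c - 1) * blinfun_apply (snd Z) (0, A *v snd (fst X)))" if "fst (fst Z) = 0" for Z :: "'a cotangent_space"
    using arg_cong[OF eq[OF that], of "\<lambda>x. blinfun_apply (snd x) (1, 0)"]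
    by (simp add: X that blinfun.scaleR_left)
  show ?R
  proof (rule ccontr)
    assume "\<not> ?R"
    then have k: "c - k * (c - 1) \<noteq> 0" "(c - 1) - k * c \<noteq> 0"
      using assms(2) by (auto simp: field_simps)
    have "(c - k * (c - 1)) * blinfun_apply \<psi> (0, A *v snd (fst X)) = 0"
      for \<psi> :: "(real \<times> (real^'a)) \<Rightarrow>\<^sub>L real"
      using eq'[of "(0, \<psi>)"] by (simp add: algebra_simps)
    then have 1: "blinfun_apply \<psi> (0, A *v snd (fst X)) = 0"
      for \<psi> :: "(real \<times> (real^'a)) \<Rightarrow>\<^sub>L real"
      using k by simp
    have "((c - 1) - k * c) * blinfun_apply (snd X) (0, A *v v) = 0" for v
      using eq'[of "((0, v), 0)"] by (simp add: algebra_simps)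
    then have 2: "blinfun_apply (snd X) (0, A *v v) = 0" for v
      using k by simp
    have "?p Y X = 0"
      by (rule cotangent_space_eqI) (auto simp: X Y 1 2 zero_prod_def)
    then show False using nz by simp
  qed
next
  assume ?R
  obtain \<psi> :: "(real \<times> (real^'a)) \<Rightarrow>\<^sub>L real" where \<psi>: "blinfun_apply \<psi> (0, A *v v0) \<noteq> 0"
    using ex_blinfun_neq_0[OF assms(1)] by blast
  let ?p = "cotangent_product A c"
  define V :: "'a cotangent_space" where "V = ((0, v0), 0)"
  define F :: "'a cotangent_space" where "F = (0, \<psi>)"
  have ratio: "?p V Y = (c / (c - 1)) *\<^sub>R ?p Y V" "?p F Y = ((c - 1) / c) *\<^sub>R ?p Y F"
    if "fst (fst Y) = 0" for Y
    using assms(2) that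
    by (auto intro!: cotangent_space_eqI simp: V_def F_def blinfun.scaleR_left zero_prod_def)
  have "blinfun_apply (snd (?p V F)) (1, 0) \<noteq> 0" "blinfun_apply (snd (?p F V)) (1, 0) \<noteq> 0"
    using assms(2) \<psi> by (auto simp: V_def F_def)
  then have "?p V F \<noteq> 0" "?p F V \<noteq> 0"
    using blinfun.zero_left by (force simp del: snd_cotangent_product_apply)+
  moreover have "fst (fst V) = 0" "fst (fst F) = 0" by (auto simp: V_def F_def)
  ultimately show ?L
    using \<open>?R\<close> ratio
    unfolding commutation_ratio_def rank_one_left_cotangent_product[OF assms(1)] by blast
qed

text \<open>Of the two ratios exactly one exceeds 1, namely \<open>c / (c - 1)\<close>, and it
  determines \<open>c\<close>.\<close>

lemma cotangent_products_not_isomorphic: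
  assumes "A *v v0 \<noteq> 0" "c > 1" "d > 1"
    and "left_symmetric_isomorphic br (cotangent_product A c) br (cotangent_product A d)"
  shows "c = d"
proof -
  have "commutation_ratio (cotangent_product A d) (c / (c - 1))"
    using commutation_ratio_isomorphic[OF assms(4)] commutation_ratio_cotangent_product[OF assms(1,2)]
    by blast
  then have "c / (c - 1) = d / (d - 1) \<or> c / (c - 1) = (d - 1) / d"
    using commutation_ratio_cotangent_product[OF assms(1,3)] by blast
  then show ?thesis
  proof
    assume "c / (c - 1) = d / (d - 1)"
    then show ?thesis using assms by (simp add: field_simps)
  next
    assume "c / (c - 1) = (d - 1) / d"
    moreover have "c / (c - 1) > 1" "(d - 1) / d < 1"
      using assms by (auto simp: field_simps)
    ultimately show ?thesis by simp
  qed
qed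

section \<open>Uncountably many isomorphism classes\<close>

lemma uncountable_cotangent_products:
  fixes A :: "real^'n^'n"
  assumes "A *v v0 \<noteq> 0"
  defines "br \<equiv> cotangent_bracket (semidirect_bracket A)"
  shows "\<exists>S. uncountable S \<and>
         (\<forall>p\<in>S. left_symmetric_structure br p \<and> complete_product p) \<and>
         pairwise (\<lambda>p q. \<not> left_symmetric_isomorphic br p br q) S"
proof (intro exI conjI)
  let ?S = "cotangent_product A ` {1<..}"
  have refl: "left_symmetric_isomorphic br p br p" for p
    unfolding left_symmetric_isomorphic_def lie_isomorphism_def
    by (rule exI[of _ id]) (simp add: linear_id)
  have iso: "c = d" if "c > 1" "d > 1"
    "left_symmetric_isomorphic br (cotangent_product A c) br (cotangent_product A d)" for c d
    using cotangent_products_not_isomorphic[OF assms(1)] that by blast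
  \<comment> \<open>Equal products are isomorphic by the identity, so non-isomorphism of the family
    already gives injectivity.\<close>
  have "inj_on (cotangent_product A) {1<..}"
  proof (rule inj_onI)
    fix c d assume "c \<in> {1<..}" "d \<in> {1<..}" "cotangent_product A c = cotangent_product A d"
    then show "c = d" using iso[of c d] refl by simp
  qed
  moreover have "uncountable {1::real<..}"
  proof
    assume "countable {1::real<..}"
    then have "countable {1<..<2::real}"
      by (rule countable_subset[rotated]) auto
    then show False using uncountable_open_interval[of 1 2] by simp
  qed
  ultimately show "uncountable ?S"
    by (auto dest: countable_image_inj_on)
  show "\<forall>p\<in>?S. left_symmetric_structure br p \<and> complete_product p"
    by (auto simp: br_def left_symmetric_structure_cotangent_product complete_cotangent_product)
  show "pairwise (\<lambda>p q. \<not> left_symmetric_isomorphic br p br q) ?S"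
    using iso by (force simp: pairwise_def)
qed

section \<open>The lower central series and the nilpotency step\<close>

lemma linear_matrix_funpow:
  fixes A :: "real^'n^'n"
  shows "linear ((*v) A ^^ k)"
  by (induction k) (simp_all only: funpow.simps linear_id linear_compose matrix_vector_mul_linear)

text \<open>Bracketing with \<open>t\<close> applies \<open>A\<close> to vectors and its negative
  transpose to functionals. Vanishing on the kernel of \<open>A^k\<close> is the range condition for
  the transposed power. The z-coefficient, read off at \<open>(1, 0)\<close>, is controlled only
  once \<open>A^k = 0\<close>.\<close>

lemma lower_central_series_cotangent_subset:
  fixes A :: "real^'n^'n"
  shows "lower_central_series (cotangent_bracket (semidirect_bracket A)) k \<subseteq>
    {X. (k > 0 \<longrightarrow> fst (fst X) = 0) \<and> snd (fst X) \<in> range ((*v) A ^^ k) \<and>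
        (\<forall>u. ((*v) A ^^ k) u = 0 \<longrightarrow> blinfun_apply (snd X) (0, u) = 0) \<and>
        (k > 0 \<longrightarrow> (\<forall>u. ((*v) A ^^ k) u = 0) \<longrightarrow> blinfun_apply (snd X) (1, 0) = 0)}"
    (is "_ \<subseteq> ?N k")
proof (induction k)
  case (Suc k)
  have range: "subspace (range ((*v) A ^^ Suc k))"
    using linear_subspace_image[OF linear_matrix_funpow subspace_UNIV] .
  have "subspace (?N (Suc k))"
    by (rule subspaceI)
      (simp_all add: blinfun.add_left blinfun.scaleR_left subspace_0[OF range]
        subspace_add[OF range] subspace_scale[OF range] del: funpow.simps)
  moreover have "cotangent_bracket (semidirect_bracket A) X Y \<in> ?N (Suc k)" if "Y \<in> ?N k" for X Y
  proof -
    have "snd (fst Y) \<in> range ((*v) A ^^ k)" using that by simp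
    then obtain w where w: "snd (fst Y) = ((*v) A ^^ k) w" by blast
    have t: "fst (fst Y) = 0" if "k > 0" using \<open>Y \<in> ?N k\<close> that by simp
    have ker: "blinfun_apply (snd Y) (0, A *v u) = 0" if "((*v) A ^^ Suc k) u = 0" for u
      using \<open>Y \<in> ?N k\<close> that by (simp add: funpow_swap1)
    have "fst (fst X) *\<^sub>R (A *v snd (fst Y)) - fst (fst Y) *\<^sub>R (A *v snd (fst X)) \<in> range ((*v) A ^^ Suc k)"
    \<comment> \<open>For \<open>k = 0\<close> both \<open>t\<close>-coefficients can be nonzero,
      and the preimage combines both vectors; for \<open>k > 0\<close> that of \<open>Y\<close> is 0
      and only one term remains.\<close>
    proof (cases "k = 0")
      case True
      then show ?thesis
        by (intro range_eqI[of _ _ "fst (fst X) *\<^sub>R snd (fst Y) - fst (fst Y) *\<^sub>R snd (fst X)"])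
          (simp add: matrix_vector_mult_diff_distrib matrix_vector_mult_scaleR)
    next
      case False
      then show ?thesis
        by (intro range_eqI[of _ _ "fst (fst X) *\<^sub>R w"])
          (simp add: t w linear_cmul[OF linear_matrix_funpow] matrix_vector_mult_scaleR)
    qed
    moreover have "fst (fst Y) * blinfun_apply (snd X) (0, A *v u) = 0" if "((*v) A ^^ Suc k) u = 0" for u
      using that t by (cases "k = 0") auto
    ultimately show ?thesis
      using ker w
      by (auto simp: cotangent_bracket_def bilinear_semidirect_bracket semidirect_bracket_def
        blinfun.diff_left blinfun_Pair0_diff blinfun_Pair0_minus)
  qed
  ultimately show ?case
    using Suc unfolding lower_central_series.simps by (intro span_minimal) blast+
qed simp

text \<open>Iterated brackets with \<open>t\<close> act on \<open>V\<close> as powers of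
  \<open>A\<close>; this keeps the series from vanishing early.\<close>

lemma funpow_in_lower_central_series:
  fixes A :: "real^'n^'n"
  shows "((0, ((*v) A ^^ k) w), 0) \<in> lower_central_series (cotangent_bracket (semidirect_bracket A)) k"
proof (induction k)
  case (Suc k)
  have "((0, ((*v) A ^^ Suc k) w), 0) =
      cotangent_bracket (semidirect_bracket A) ((1, 0), 0) ((0, ((*v) A ^^ k) w), 0)"
    by (rule cotangent_space_eqI)
      (auto simp: cotangent_bracket_def bilinear_semidirect_bracket semidirect_bracket_def
        blinfun.diff_left)
  then show ?case
    using Suc unfolding lower_central_series.simps by (intro span_base) blast
qed simp

lemma step_nilpotent_cotangent_bracket:
  fixes A :: "real^'n^'n"
  assumes "n > 0" "\<And>u. ((*v) A ^^ n) u = 0" "((*v) A ^^ (n - 1)) w \<noteq> 0"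
  shows "step_nilpotent n (cotangent_bracket (semidirect_bracket A))"
  unfolding step_nilpotent_def
proof (intro conjI allI impI)
  let ?L = "lower_central_series (cotangent_bracket (semidirect_bracket A))"
  have "X = 0" if "X \<in> ?L n" for X
  proof (rule cotangent_space_eqI)
    note X = subsetD[OF lower_central_series_cotangent_subset that]
    show "fst X = fst 0" using X assms(1,2) by (auto intro!: prod_eqI)
    fix y
    have "blinfun_apply (snd X) y = blinfun_apply (snd X) (fst y *\<^sub>R (1, 0) + (0, snd y))"
      by simp
    also have "\<dots> = 0"
      using X assms(1,2) unfolding blinfun.add_right blinfun.scaleR_right by simp
    finally show "blinfun_apply (snd X) y = blinfun_apply (snd 0) y" by simp
  qed
  moreover have "0 \<in> ?L n"
    using assms(1) by (cases n) (auto simp: span_zero)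
  ultimately show "?L n = {0}" by blast
  fix k assume "k < n"
  \<comment> \<open>\<open>A^(n - 1)\<close> factors through \<open>A^k\<close>, so a vector that
    survives the former survives the latter.\<close>
  then have "(*v) A ^^ (n - 1) = ((*v) A ^^ (n - 1 - k)) \<circ> ((*v) A ^^ k)"
    by (simp flip: funpow_add)
  then have "((*v) A ^^ k) w \<noteq> 0"
    using assms(3) linear_0[OF linear_matrix_funpow[of "n - 1 - k" A]] by auto
  then have "((0, ((*v) A ^^ k) w), 0) \<notin> {0}"
    by (simp add: zero_prod_def)
  then show "?L k \<noteq> {0}"
    using funpow_in_lower_central_series[of k A w] by metis
qed

section \<open>Powers of the nilpotent Jordan block\<close>

context
  fixes n :: nat and idx :: "nat \<Rightarrow> 'n::finite"
  assumes idx: "bij_betw idx {1..n} UNIV"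
begin

lemma jordan_block_axis:
  assumes "k \<in> {1..n}"
  shows "jordan_block_matrix idx n 0 *v axis (idx k) 1 = (if k = 1 then 0 else axis (idx (k - 1)) 1)"
proof -
  have inj: "idx i = idx j \<longleftrightarrow> i = j" if "i \<in> {1..n}" "j \<in> {1..n}" for i j
    using idx that by (auto simp: bij_betw_def inj_on_eq_iff)
  have "(\<exists>l\<in>{1..<n}. i = idx l \<and> idx k = idx (Suc l)) \<longleftrightarrow> k \<noteq> 1 \<and> i = idx (k - 1)" for i
  proof
    assume "\<exists>l\<in>{1..<n}. i = idx l \<and> idx k = idx (Suc l)"
    then obtain l where "l \<in> {1..<n}" "i = idx l" "idx k = idx (Suc l)" by blast
    then show "k \<noteq> 1 \<and> i = idx (k - 1)" using inj[of k "Suc l"] assms by auto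
  next
    assume "k \<noteq> 1 \<and> i = idx (k - 1)"
    then show "\<exists>l\<in>{1..<n}. i = idx l \<and> idx k = idx (Suc l)"
      using assms by (intro bexI[of _ "k - 1"]) auto
  qed
  \<comment> \<open>The matrix tests for the diagonal first, so the entry 1 must be seen to lie off
    it.\<close>
  moreover have "idx k \<noteq> idx (k - 1)" if "k \<noteq> 1"
  proof -
    have "k - 1 \<in> {1..n}" using assms that by auto
    then show ?thesis using inj[of k "k - 1"] assms by auto
  qed
  moreover have "(jordan_block_matrix idx n 0 *v axis (idx k) 1) $ i =
      jordan_block_matrix idx n 0 $ i $ idx k" for i
    by (simp add: matrix_vector_mult_basis column_def)
  ultimately show ?thesis
    by (auto simp: vec_eq_iff jordan_block_matrix_def axis_def)
qed

lemma jordan_block_funpow_axis: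
  assumes "k \<in> {1..n}"
  shows "((*v) (jordan_block_matrix idx n 0) ^^ m) (axis (idx k) 1) =
    (if k \<le> m then 0 else axis (idx (k - m)) 1)"
proof (induction m)
  case (Suc m)
  show ?case
  proof (cases "k \<le> m")
    case True
    then show ?thesis using Suc by simp
  next
    case False
    then have "k - m \<in> {1..n}" using assms by auto
    then show ?thesis using Suc False jordan_block_axis[of "k - m"] by auto
  qed
qed (use assms in simp)

lemma jordan_block_funpow_eq_0: "((*v) (jordan_block_matrix idx n 0) ^^ n) u = 0"
proof -
  let ?f = "(*v) (jordan_block_matrix idx n 0) ^^ n"
  have "?f b = 0" if b: "b \<in> Basis" for b
  proof -
    obtain i where "b = axis i 1"
      using b by (auto simp: Basis_vec_def)
    moreover obtain k where "k \<in> {1..n}" "i = idx k"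
      using idx unfolding bij_betw_def by (metis UNIV_I imageE)
    ultimately show ?thesis by (simp add: jordan_block_funpow_axis)
  qed
  then show ?thesis
    using linear_eq_stdbasis[OF linear_matrix_funpow linear_zero] by metis
qed

end

theorem corollary3p3:
  fixes n :: nat and idx :: "nat \<Rightarrow> 'n::finite"
  assumes "n \<ge> 2"
    and "bij_betw idx {1..n} (UNIV :: 'n set)"
  shows "lie_algebra (cotangent_jordan_bracket idx n) \<and>
    step_nilpotent n (cotangent_jordan_bracket idx n) \<and>
    (\<exists>S. uncountable S \<and>
         (\<forall>p\<in>S. left_symmetric_structure (cotangent_jordan_bracket idx n) p \<and>
                complete_product p) \<and>
         pairwise (\<lambda>p q. \<not> left_symmetric_isomorphic
                           (cotangent_jordan_bracket idx n) p
                           (cotangent_jordan_bracket idx n) q) S)"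
  unfolding cotangent_jordan_bracket_def
proof (intro conjI)
  let ?J = "jordan_block_matrix idx n 0"
  show "lie_algebra (cotangent_bracket (semidirect_bracket ?J))"
    by (rule lie_algebra_cotangent_bracket)
  \<comment> \<open>The last basis vector reaches \<open>axis (idx 1) 1\<close> after
    \<open>n - 1\<close> steps.\<close>
  have "((*v) ?J ^^ (n - 1)) (axis (idx n) 1) \<noteq> 0"
    using assms by (simp add: jordan_block_funpow_axis)
  then show "step_nilpotent n (cotangent_bracket (semidirect_bracket ?J))"
    using assms by (intro step_nilpotent_cotangent_bracket jordan_block_funpow_eq_0) auto
  \<comment> \<open>Here \<open>n \<ge> 2\<close> enters: for \<open>n = 1\<close> the block would
    be 0.\<close>
  have "?J *v axis (idx n) 1 \<noteq> 0"
    using assms by (simp add: jordan_block_axis)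
  then show "\<exists>S. uncountable S \<and>
      (\<forall>p\<in>S. left_symmetric_structure (cotangent_bracket (semidirect_bracket ?J)) p \<and>
        complete_product p) \<and>
      pairwise (\<lambda>p q. \<not> left_symmetric_isomorphic (cotangent_bracket (semidirect_bracket ?J)) p
        (cotangent_bracket (semidirect_bracket ?J)) q) S"
    by (rule uncountable_cotangent_products)
qed

end
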